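(* Let $B$ be a set of Cayley permutations and $\operatorname{Av}(B)$ the set of Cayley permutations avoiding every element of $B$. Then there exists a positive integer $k$ with $\operatorname{Av}(B) \subseteq \mathcal{SB}(k)$ if and only if $B$ contains at least one Cayley permutation from each of the nine classes $\mathcal{V}_{A,B'}$ with $A, B' \in \{I, D, C\}$.
   Context: A Cayley permutation is a word over the positive integers in which every integer between $1$ and its maximum occurs. Standardisation replaces the smallest value of a word by $1$, the next smallest by $2$, etc.; $w$ contains $p$ if some subsequence of $w$ standardises to $p$, and avoids it otherwise. Vertical evolution: a Cayley permutation is built from the empty word by inserting its entries in increasing order of value, and among equal values from left to right; a configuration records the entries placed so far in their relative positions together with one slot $\diamond$ for each maximal block of consecutive positions not yet filled (starting from $\diamond$). $\mathcal{SB}(k)$ is the set of Cayley permutations all of whose configurations in their vertical evolution have at most $k$ slots. A Cayley permutation $\pi$ with maximum value $n+k$ is a vertical juxtaposition of a Cayley permutation $\sigma$ with maximum $n$ and a Cayley permutation $\tau$ with maximum $k$ if the entries of $\pi$ with values at most $n$ standardise to $\sigma$ and the entries with values larger than $n$ standardise to $\tau$. For $A,B'\in\{I,D,C\}$, $\mathcal{V}_{A,B'}$ is the set of vertical juxtapositions of a (possibly empty) sequence of type $A$ with a (possibly empty) sequence of type $B'$, where $I$ means strictly increasing, $D$ strictly decreasing and $C$ constant. *)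

theory Defs
  imports Main "HOL-Library.Sublist"
begin

text \<open>The empty word has maximum 0, so it is a Cayley permutation.\<close>
definition max_value :: "nat list \<Rightarrow> nat" where
  "max_value w = Max (insert 0 (set w))"

definition cayley_perms :: "nat list set" where
  "cayley_perms = {w. set w = {1..max_value w}}"

definition standardise :: "nat list \<Rightarrow> nat list" where
  "standardise w = map (\<lambda>x. card {y \<in> set w. y \<le> x}) w"

definition contains :: "nat list \<Rightarrow> nat list \<Rightarrow> bool" where
  "contains w p \<longleftrightarrow> (\<exists>u. subseq u w \<and> standardise u = p)"

definition Av :: "nat list set \<Rightarrow> nat list set" where
  "Av B = {w \<in> cayley_perms. \<forall>p\<in>B. \<not> contains w p}"

text \<open>
  The positions of a word in the order in which the vertical evolution fills them. Since
  \<^const>\<open>sort_key\<close> is stable, positions carrying equal values are listed from left to right.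
\<close>
definition insertion_order :: "nat list \<Rightarrow> nat list" where
  "insertion_order w = sort_key (\<lambda>i. w ! i) [0..<length w]"

text \<open>
  In a configuration, \<^term>\<open>Some v\<close> is an entry of value \<^term>\<open>v\<close> and \<^term>\<open>None\<close> is a slot.
\<close>
fun merge_slots :: "nat option list \<Rightarrow> nat option list" where
  "merge_slots (None # None # xs) = merge_slots (None # xs)"
| "merge_slots (x # xs) = x # merge_slots xs"
| "merge_slots [] = []"

text \<open>
  The configuration after \<^term>\<open>t\<close> insertions. The evolution starts from a single slot; the case
  distinction matters only for the empty word.
\<close>
definition configuration :: "nat list \<Rightarrow> nat \<Rightarrow> nat option list" where
  "configuration w t =
     (if t = 0 then [None]
      else merge_slots (map (\<lambda>i. if i \<in> set (take t (insertion_order w)) then Some (w ! i) else None)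
                            [0..<length w]))"

definition slots :: "nat option list \<Rightarrow> nat" where
  "slots c = count_list c None"

definition SB :: "nat \<Rightarrow> nat list set" where
  "SB k = {w \<in> cayley_perms. \<forall>t\<le>length w. slots (configuration w t) \<le> k}"

definition vertical_juxtaposition :: "nat list \<Rightarrow> nat list \<Rightarrow> nat list \<Rightarrow> bool" where
  "vertical_juxtaposition \<pi> \<sigma> \<tau> \<longleftrightarrow>
     \<pi> \<in> cayley_perms \<and> \<sigma> \<in> cayley_perms \<and> \<tau> \<in> cayley_perms \<and>
     max_value \<pi> = max_value \<sigma> + max_value \<tau> \<and>
     standardise (filter (\<lambda>x. x \<le> max_value \<sigma>) \<pi>) = \<sigma> \<and>
     standardise (filter (\<lambda>x. x > max_value \<sigma>) \<pi>) = \<tau>"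

datatype seq_type = Incr | Decr | Constant

fun has_type :: "seq_type \<Rightarrow> nat list \<Rightarrow> bool" where
  "has_type Incr w \<longleftrightarrow> sorted_wrt (<) w"
| "has_type Decr w \<longleftrightarrow> sorted_wrt (>) w"
| "has_type Constant w \<longleftrightarrow> (\<forall>x\<in>set w. \<forall>y\<in>set w. x = y)"

definition vert_class :: "seq_type \<Rightarrow> seq_type \<Rightarrow> nat list set" where
  "vert_class A A' =
     {\<pi>. \<exists>\<sigma> \<tau>. vertical_juxtaposition \<pi> \<sigma> \<tau> \<and> has_type A \<sigma> \<and> has_type A' \<tau>}"

end

theory Submission
  imports Defs
begin

text \<open>
  If a word has a configuration with many slots, then slots alternate with filled blocks, which
  gives a long alternation of small and large entries. Discarding half of it separates small from
  large strictly, and Ramsey's theorem, applied once to the small and once to the large entries,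
  makes both parts increasing, decreasing or constant. Such an alternation of type \<open>(A, A')\<close>
  contains every sufficiently short member of the class of that type. Conversely, the
  alternations of type \<open>(A, A')\<close> have unboundedly many slots and contain only patterns of
  that class.
\<close>

section \<open>Standardisation\<close>

text \<open>If \<open>y < x\<close>, then \<open>x\<close> itself is counted on the left and not on
  the right. \<open>y\<close> ranges over all values, so it may be a threshold that does not occur
  in the word.\<close>

lemma card_le_iff_le:
  fixes x y :: "'a :: linorder"
  assumes "finite S" "x \<in> S"
  shows "card {z \<in> S. z \<le> x} \<le> card {z \<in> S. z \<le> y} \<longleftrightarrow> x \<le> y"
proof (cases "x \<le> y")
  case True
  then have "{z \<in> S. z \<le> x} \<subseteq> {z \<in> S. z \<le> y}" by auto
  with True assms show ?thesis by (simp add: card_mono)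
next
  case False
  with assms have "{z \<in> S. z \<le> y} \<subset> {z \<in> S. z \<le> x}" by force
  with assms have "card {z \<in> S. z \<le> y} < card {z \<in> S. z \<le> x}"
    by (intro psubset_card_mono) auto
  with False show ?thesis by simp
qed

lemma length_standardise [simp]: "length (standardise w) = length w"
  by (simp add: standardise_def)

lemma standardise_nth_le_iff:
  assumes "i < length w" "j < length w"
  shows "standardise w ! i \<le> standardise w ! j \<longleftrightarrow> w ! i \<le> w ! j"
  using assms by (simp add: standardise_def card_le_iff_le)

lemma standardise_map:
  assumes "strict_mono_on (set w) h"
  shows "standardise (map h w) = standardise w"
proof -
  have "card {y \<in> h ` set w. y \<le> h x} = card {y \<in> set w. y \<le> x}" if "x \<in> set w" for x
  proof -
    have "{y \<in> h ` set w. y \<le> h x} = h ` {y \<in> set w. y \<le> x}"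
      using that assms by (auto simp: strict_mono_on_less_eq)
    moreover have "inj_on h {y \<in> set w. y \<le> x}"
      using strict_mono_on_imp_inj_on[OF assms] by (rule inj_on_subset) auto
    ultimately show ?thesis by (simp add: card_image)
  qed
  then show ?thesis by (simp add: standardise_def)
qed

text \<open>Equal comparisons between positions make \<open>w\<close> a strictly monotone
  relabelling of \<open>v\<close>, and such relabellings preserve ranks.\<close>

lemma standardise_cong:
  assumes len: "length v = length w"
    and iff: "\<And>i j. i < length w \<Longrightarrow> j < length w \<Longrightarrow> v ! i \<le> v ! j \<longleftrightarrow> w ! i \<le> w ! j"
  shows "standardise v = standardise w"
proof -
  \<comment> \<open>\<open>h\<close> reads \<open>w\<close> at some position where \<open>v\<close>
    has value \<open>x\<close>; the choice is immaterial, because positions that tie in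
    \<open>v\<close> also tie in \<open>w\<close>.\<close>
  define h where "h x = w ! (SOME i. i < length v \<and> v ! i = x)" for x
  have h: "h (v ! i) = w ! i" if "i < length v" for i
  proof -
    define j where "j = (SOME j. j < length v \<and> v ! j = v ! i)"
    have "j < length v \<and> v ! j = v ! i"
      unfolding j_def by (rule someI[of _ i]) (use that in simp)
    then have "w ! j = w ! i"
      using that len iff[of i j] iff[of j i] by (auto intro: antisym)
    then show ?thesis by (simp add: h_def j_def)
  qed
  have "map h v = w" using h len by (auto intro: nth_equalityI)
  moreover have "strict_mono_on (set v) h"
  proof (rule strict_mono_onI)
    fix x y assume "x \<in> set v" "y \<in> set v" "x < y"
    then obtain i j where ij: "i < length v" "j < length v" "x = v ! i" "y = v ! j"
      by (metis in_set_conv_nth)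
    with \<open>x < y\<close> iff[of j i] show "h x < h y" by (simp add: h len not_le[symmetric])
  qed
  ultimately show ?thesis using standardise_map by metis
qed

lemma standardise_cayley:
  assumes "w \<in> cayley_perms"
  shows "standardise w = w"
proof -
  have set: "set w = {1..max_value w}" using assms by (simp add: cayley_perms_def)
  have "card {y \<in> set w. y \<le> x} = x" if "x \<in> set w" for x
  proof -
    have "{y \<in> set w. y \<le> x} = {1..x}" using that set by auto
    then show ?thesis by simp
  qed
  then show ?thesis by (simp add: standardise_def map_idI)
qed

text \<open>Ranks are injective and lie between 1 and the number of distinct values, so by counting
  they exhaust that range.\<close>

lemma set_standardise: "set (standardise w) = {1..card (set w)}"
proof (rule card_subset_eq)
  define r where "r x = card {y \<in> set w. y \<le> x}" for x
  have r: "set (standardise w) = r ` set w" by (simp add: standardise_def r_def)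
  have "1 \<le> r x \<and> r x \<le> card (set w)" if "x \<in> set w" for x
  proof -
    have "{y \<in> set w. y \<le> x} \<noteq> {}" using that by auto
    then have "0 < r x" by (simp add: r_def card_gt_0_iff)
    moreover have "r x \<le> card (set w)" unfolding r_def by (rule card_mono) auto
    ultimately show ?thesis by simp
  qed
  then show "set (standardise w) \<subseteq> {1..card (set w)}" using r by auto
  have "inj_on r (set w)"
    unfolding inj_on_def r_def using card_le_iff_le[of "set w"]
    by (metis (no_types, lifting) List.finite_set order.antisym order.refl)
  then show "card (set (standardise w)) = card {1..card (set w)}" by (simp add: r card_image)
qed simp

lemma Max_insert_0_atLeastAtMost: "Max (insert 0 {1..n :: nat}) = n"
  by (rule Max_eqI) auto

lemma max_value_eq: "set w = {1..n} \<Longrightarrow> max_value w = n"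
  unfolding max_value_def by (simp only: Max_insert_0_atLeastAtMost)

lemma max_value_standardise: "max_value (standardise w) = card (set w)"
  by (rule max_value_eq[OF set_standardise])

lemma standardise_in_cayley_perms: "standardise w \<in> cayley_perms"
  by (simp add: cayley_perms_def max_value_standardise set_standardise)

section \<open>Vertical juxtapositions\<close>

text \<open>A pairwise form of \<open>has_type\<close>: all three types become instances of
  \<open>sorted_wrt\<close>, which passes to subsequences.\<close>

fun type_rel :: "seq_type \<Rightarrow> nat \<Rightarrow> nat \<Rightarrow> bool" where
  "type_rel Incr x y \<longleftrightarrow> x < y"
| "type_rel Decr x y \<longleftrightarrow> x > y"
| "type_rel Constant x y \<longleftrightarrow> x = y"

lemma has_type_iff_sorted_wrt: "has_type A w \<longleftrightarrow> sorted_wrt (type_rel A) w"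
proof (cases A)
  case Constant
  have "(\<forall>x\<in>set w. \<forall>y\<in>set w. x = y) \<longleftrightarrow> sorted_wrt (=) w"
    by (induction w) auto
  moreover have "type_rel Constant = (=)" by (intro ext) simp
  ultimately show ?thesis using Constant by simp
next
  case Incr
  moreover have "type_rel Incr = (<)" by (intro ext) simp
  ultimately show ?thesis by simp
next
  case Decr
  moreover have "type_rel Decr = (>)" by (intro ext) simp
  ultimately show ?thesis by simp
qed

text \<open>The type alone fixes how two entries compare, so sequences of equal type and length are
  order isomorphic.\<close>

lemma type_rel_le_iff:
  assumes "type_rel A x y" "type_rel A x' y'"
  shows "x \<le> y \<longleftrightarrow> x' \<le> y'" "y \<le> x \<longleftrightarrow> y' \<le> x'"
  using assms by (cases A; auto)+

lemma type_rel_cong: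
  assumes "x' \<le> y' \<longleftrightarrow> x \<le> y" "y' \<le> x' \<longleftrightarrow> y \<le> x"
  shows "type_rel A x' y' \<longleftrightarrow> type_rel A x y"
  using assms by (cases A) (auto simp: not_le[symmetric])

lemma sorted_wrt_type_rel_standardise:
  "sorted_wrt (type_rel A) (standardise w) \<longleftrightarrow> sorted_wrt (type_rel A) w"
proof -
  have "type_rel A (standardise w ! i) (standardise w ! j) \<longleftrightarrow> type_rel A (w ! i) (w ! j)"
    if "i < j" "j < length w" for i j
    by (rule type_rel_cong) (use that in \<open>simp_all add: standardise_nth_le_iff\<close>)
  then show ?thesis by (simp add: sorted_wrt_iff_nth_less)
qed

text \<open>Moves the filter into the relation, so that indices keep referring to the unfiltered
  word.\<close>

lemma sorted_wrt_filter_iff: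
  "sorted_wrt R (filter P xs) \<longleftrightarrow> sorted_wrt (\<lambda>x y. P x \<longrightarrow> P y \<longrightarrow> R x y) xs"
  by (induction xs) auto

lemma set_mono_subseq: "subseq xs ys \<Longrightarrow> set xs \<subseteq> set ys"
  by (induction rule: list_emb.induct) auto

lemma sorted_wrt_subseq:
  assumes "sorted_wrt R ys" "subseq xs ys"
  shows "sorted_wrt R xs"
  using assms(2,1)
  by (induction rule: list_emb.induct) (auto dest: set_mp[OF set_mono_subseq])

section \<open>Words split by a threshold\<close>

text \<open>Expresses vertical classes without the witnesses \<open>\<sigma>\<close> and
  \<open>\<tau>\<close>. It makes sense for arbitrary words and thresholds and can thus be followed
  through subsequences and standardisation.\<close>

definition split_type :: "seq_type \<Rightarrow> seq_type \<Rightarrow> nat \<Rightarrow> nat list \<Rightarrow> bool" where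
  "split_type A A' m w \<longleftrightarrow>
     sorted_wrt (type_rel A) (filter (\<lambda>x. x \<le> m) w) \<and>
     sorted_wrt (type_rel A') (filter (\<lambda>x. m < x) w)"

lemma split_type_subseq: "split_type A A' m w \<Longrightarrow> subseq u w \<Longrightarrow> split_type A A' m u"
  unfolding split_type_def by (blast intro: sorted_wrt_subseq subseq_filter)

text \<open>The threshold is replaced by its rank, which selects the same positions of the
  standardised word.\<close>

lemma split_type_standardise:
  assumes "split_type A A' m w"
  shows "split_type A A' (card {y \<in> set w. y \<le> m}) (standardise w)"
proof -
  define r where "r x = card {y \<in> set w. y \<le> x}" for x
  have le: "r x \<le> r y \<longleftrightarrow> x \<le> y" if "x \<in> set w" for x y
    using that by (simp add: r_def card_le_iff_le)
  have rel: "type_rel C (r x) (r y) \<longleftrightarrow> type_rel C x y" if "x \<in> set w" "y \<in> set w" for C x y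
    by (rule type_rel_cong) (use that le in auto)
  have sorted: "sorted_wrt (type_rel C) (map r v)"
    if "sorted_wrt (type_rel C) v" "set v \<subseteq> set w" for C v
    unfolding sorted_wrt_map using that(1)
    by (rule sorted_wrt_mono_rel[rotated]) (use that(2) rel in blast)
  have st: "standardise w = map r w" by (simp add: standardise_def r_def)
  have 1: "filter (\<lambda>x. x \<le> r m) (map r w) = map r (filter (\<lambda>x. x \<le> m) w)"
    by (auto simp: filter_map o_def le cong: filter_cong)
  have 2: "filter (\<lambda>x. r m < x) (map r w) = map r (filter (\<lambda>x. m < x) w)"
    by (auto simp: filter_map o_def le not_le[symmetric] cong: filter_cong)
  show ?thesis
    using assms unfolding split_type_def r_def[symmetric] st 1 2
    by (auto intro!: sorted)
qed

lemma split_type_min_max_value: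
  assumes "split_type A A' m w"
  shows "split_type A A' (min m (max_value w)) w"
proof -
  have "x \<le> min m (max_value w) \<longleftrightarrow> x \<le> m" if "x \<in> set w" for x
    using that by (simp add: max_value_def)
  then have "filter (\<lambda>x. x \<le> min m (max_value w)) w = filter (\<lambda>x. x \<le> m) w"
    "filter (\<lambda>x. min m (max_value w) < x) w = filter (\<lambda>x. m < x) w"
    by (auto intro!: filter_cong simp: not_le[symmetric] simp del: min.bounded_iff)
  with assms show ?thesis by (simp add: split_type_def)
qed

lemma vert_class_iff:
  "w \<in> vert_class A A' \<longleftrightarrow> w \<in> cayley_perms \<and> (\<exists>m. split_type A A' m w)"
proof (intro iffI conjI)
  assume "w \<in> vert_class A A'"
  then obtain \<sigma> \<tau> where v: "vertical_juxtaposition w \<sigma> \<tau>" and "has_type A \<sigma>" "has_type A' \<tau>"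
    by (auto simp: vert_class_def)
  then show "w \<in> cayley_perms" by (simp add: vertical_juxtaposition_def)
  have "standardise (filter (\<lambda>x. x \<le> max_value \<sigma>) w) = \<sigma>"
    "standardise (filter (\<lambda>x. x > max_value \<sigma>) w) = \<tau>"
    using v by (simp_all add: vertical_juxtaposition_def)
  then have "split_type A A' (max_value \<sigma>) w"
    using \<open>has_type A \<sigma>\<close> \<open>has_type A' \<tau>\<close>
    unfolding split_type_def has_type_iff_sorted_wrt
    by (metis sorted_wrt_type_rel_standardise)
  then show "\<exists>m. split_type A A' m w" ..
next
  assume r: "w \<in> cayley_perms \<and> (\<exists>m. split_type A A' m w)"
  then obtain m0 where m0: "split_type A A' m0 w" by blast
  \<comment> \<open>Capping the threshold at the maximum selects the same entries and ensures that
    the lower part has exactly the values from 1 to \<open>m\<close>, so that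
    \<open>max_value \<sigma> = m\<close>.\<close>
  define m where "m = min m0 (max_value w)"
  have m: "split_type A A' m w" unfolding m_def by (rule split_type_min_max_value[OF m0])
  have set: "set w = {1..max_value w}" using r by (simp add: cayley_perms_def)
  define \<sigma> where "\<sigma> = standardise (filter (\<lambda>x. x \<le> m) w)"
  define \<tau> where "\<tau> = standardise (filter (\<lambda>x. x > m) w)"
  have "m \<le> max_value w" by (simp add: m_def)
  then have sets: "set (filter (\<lambda>x. x \<le> m) w) = {1..m}"
    "set (filter (\<lambda>x. x > m) w) = {m<..max_value w}"
    using set by auto
  have \<sigma>: "max_value \<sigma> = m" unfolding \<sigma>_def max_value_standardise sets by simp
  have \<tau>: "max_value \<tau> = max_value w - m" unfolding \<tau>_def max_value_standardise sets by simp
  have "vertical_juxtaposition w \<sigma> \<tau>"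
    unfolding vertical_juxtaposition_def \<sigma> \<tau>
    using r \<open>m \<le> max_value w\<close> by (simp add: \<sigma>_def \<tau>_def standardise_in_cayley_perms)
  moreover have "has_type A \<sigma>" "has_type A' \<tau>"
    using m by (auto simp: split_type_def has_type_iff_sorted_wrt \<sigma>_def \<tau>_def
        sorted_wrt_type_rel_standardise)
  ultimately show "w \<in> vert_class A A'" unfolding vert_class_def by blast
qed

lemma standardise_in_vert_class: "split_type A A' m w \<Longrightarrow> standardise w \<in> vert_class A A'"
  by (auto simp: vert_class_iff standardise_in_cayley_perms dest: split_type_standardise)

text \<open>A threshold survives both deleting entries and standardising, so each class is closed
  under taking patterns.\<close>

lemma vert_class_contains:
  "w \<in> vert_class A A' \<Longrightarrow> contains w p \<Longrightarrow> p \<in> vert_class A A'"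
  by (auto simp: vert_class_iff[of w] contains_def
      intro: standardise_in_vert_class split_type_subseq)

section \<open>The order of insertion\<close>

text \<open>Sorting by value gives the weak inequality. Stability settles ties: positions of one
  value keep their order from \<open>[0..<length w]\<close>.\<close>

lemma sorted_wrt_insertion_order:
  "sorted_wrt (\<lambda>i j. w ! i < w ! j \<or> w ! i = w ! j \<and> i < j) (insertion_order w)"
  unfolding sorted_wrt_iff_nth_less
proof (intro allI impI)
  define xs where "xs = insertion_order w"
  fix a b assume ab: "a < b" "b < length (insertion_order w)"
  have "sorted (map ((!) w) xs)"
    unfolding xs_def insertion_order_def by simp
  then have le: "w ! (xs ! a) \<le> w ! (xs ! b)"
    using ab by (auto simp: sorted_iff_nth_mono_less xs_def)
  have "xs ! a < xs ! b" if "w ! (xs ! a) = w ! (xs ! b)"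
  proof -
    have "filter (\<lambda>i. w ! i = w ! (xs ! b)) xs = filter (\<lambda>i. w ! i = w ! (xs ! b)) [0..<length w]"
      unfolding xs_def insertion_order_def by (rule sort_key_stable)
    moreover have "sorted_wrt (<) (filter (\<lambda>i. w ! i = w ! (xs ! b)) [0..<length w])"
      by (simp add: sorted_wrt_filter)
    ultimately have "sorted_wrt (<) (filter (\<lambda>i. w ! i = w ! (xs ! b)) xs)" by simp
    from sorted_wrt_nth_less[OF this[unfolded sorted_wrt_filter_iff] ab(1)] show ?thesis
      using ab that by (simp add: xs_def)
  qed
  with le show "w ! (insertion_order w ! a) < w ! (insertion_order w ! b) \<or>
      w ! (insertion_order w ! a) = w ! (insertion_order w ! b) \<and>
      insertion_order w ! a < insertion_order w ! b"
    by (auto simp: xs_def)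
qed

lemma set_insertion_order: "set (insertion_order w) = {..<length w}"
  by (auto simp: insertion_order_def)

lemma distinct_insertion_order: "distinct (insertion_order w)"
  by (simp add: insertion_order_def)

lemma length_insertion_order: "length (insertion_order w) = length w"
  by (simp add: insertion_order_def)

lemma filled_before_unfilled:
  assumes "i \<in> set (take t (insertion_order w))" "j < length w"
    "j \<notin> set (take t (insertion_order w))"
  shows "w ! i < w ! j \<or> w ! i = w ! j \<and> i < j"
proof -
  have "j \<in> set (insertion_order w)" using assms(2) by (simp add: set_insertion_order)
  then have "j \<in> set (drop t (insertion_order w))"
    using assms(3) by (metis UnE append_take_drop_id set_append)
  moreover have "sorted_wrt (\<lambda>i j. w ! i < w ! j \<or> w ! i = w ! j \<and> i < j)
      (take t (insertion_order w) @ drop t (insertion_order w))"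
    by (simp add: sorted_wrt_insertion_order)
  ultimately show ?thesis using assms(1) unfolding sorted_wrt_append by blast
qed

section \<open>Slots\<close>

text \<open>After merging, an entry stands between any two slots, so every slot but the last is
  followed by an entry before the next slot; hence the \<open>- 1\<close>.\<close>

lemma subseq_alternation_merge_slots:
  "subseq (concat (replicate (slots (merge_slots xs) - 1) [True, False]))
     (map (\<lambda>x. x = None) xs)"
proof (induction xs rule: merge_slots.induct)
  case ("2_2" x)
  then show ?case by (cases x) (simp_all add: slots_def)
next
  case ("2_3" x y xs)
  then show ?case
    by (cases x; cases "slots (merge_slots xs) - 1"; cases "slots (merge_slots xs)")
      (auto simp: slots_def)
qed (auto simp: slots_def)

lemma slots_merge_slots_alternating:
  "slots (merge_slots (concat (map (\<lambda>i. [Some (g i), None]) xs))) = length xs"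
proof (induction xs)
  case Nil
  then show ?case by (simp add: slots_def)
next
  case (Cons x xs)
  then show ?case by (cases xs) (simp_all add: slots_def)
qed

lemma map_upt_double:
  "map h [0..<2 * n] = concat (map (\<lambda>i. [h (2 * i), h (2 * i + 1)]) [0..<n])"
  by (induction n) auto

section \<open>Monotone subsequences\<close>

text \<open>Separate targets \<open>a\<close> and \<open>b\<close> let the induction lower one at a
  time: the first element splits the rest into elements related and unrelated to it, and can be
  prepended to what is found in either part.\<close>

lemma ramsey_list_asymmetric:
  "\<exists>N. \<forall>P (xs :: 'a list). N \<le> length xs \<longrightarrow>
     (\<exists>ys. subseq ys xs \<and> (length ys = a \<and> sorted_wrt P ys \<or>
                           length ys = b \<and> sorted_wrt (\<lambda>x y. \<not> P x y) ys))"
proof (induction "a + b" arbitrary: a b)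
  case 0
  then show ?case by (intro exI[of _ 0] allI impI exI[of _ "[]"]) simp
next
  case (Suc s)
  show ?case
  proof (cases "a = 0 \<or> b = 0")
    case True
    then show ?thesis by (intro exI[of _ 0] allI impI exI[of _ "[]"]) auto
  next
    case False
    then obtain a' b' where ab: "a = Suc a'" "b = Suc b'" by (metis not0_implies_Suc)
    obtain N1 where N1: "\<And>P (xs :: 'a list). N1 \<le> length xs \<Longrightarrow>
      \<exists>ys. subseq ys xs \<and> (length ys = a' \<and> sorted_wrt P ys \<or>
                           length ys = b \<and> sorted_wrt (\<lambda>x y. \<not> P x y) ys)"
      using Suc.hyps(1)[of a' b] Suc.hyps(2) ab by auto
    obtain N2 where N2: "\<And>P (xs :: 'a list). N2 \<le> length xs \<Longrightarrow>
      \<exists>ys. subseq ys xs \<and> (length ys = a \<and> sorted_wrt P ys \<or>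
                           length ys = b' \<and> sorted_wrt (\<lambda>x y. \<not> P x y) ys)"
      using Suc.hyps(1)[of a b'] Suc.hyps(2) ab by auto
    show ?thesis
    proof (intro exI[of _ "Suc (N1 + N2)"] allI impI)
      fix P and xs :: "'a list" assume "Suc (N1 + N2) \<le> length xs"
      then obtain z zs where xs: "xs = z # zs" and len: "N1 + N2 \<le> length zs"
        by (cases xs) auto
      have sub: "subseq ys (filter Q zs) \<Longrightarrow> subseq ys zs \<and> (\<forall>y\<in>set ys. Q y)" for ys Q
        using set_mono_subseq[of ys "filter Q zs"]
          subseq_order.order_trans[OF _ subseq_filter_left[of Q zs], of ys] by auto
      have "N1 \<le> length (filter (P z) zs) \<or> N2 \<le> length (filter (\<lambda>y. \<not> P z y) zs)"
        using len sum_length_filter_compl[of "P z" zs] by linarith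
      then show "\<exists>ys. subseq ys xs \<and> (length ys = a \<and> sorted_wrt P ys \<or>
                           length ys = b \<and> sorted_wrt (\<lambda>x y. \<not> P x y) ys)"
      proof
        assume "N1 \<le> length (filter (P z) zs)"
        from N1[OF this] obtain ys where ys: "subseq ys (filter (P z) zs)"
          "length ys = a' \<and> sorted_wrt P ys \<or> length ys = b \<and> sorted_wrt (\<lambda>x y. \<not> P x y) ys"
          by blast
        from ys(2) show ?thesis
        proof
          assume "length ys = a' \<and> sorted_wrt P ys"
          then show ?thesis
            using sub[OF ys(1)] by (intro exI[of _ "z # ys"]) (simp add: ab xs)
        next
          assume "length ys = b \<and> sorted_wrt (\<lambda>x y. \<not> P x y) ys"
          then show ?thesis
            using sub[OF ys(1)] by (intro exI[of _ ys]) (auto simp: xs)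
        qed
      next
        assume "N2 \<le> length (filter (\<lambda>y. \<not> P z y) zs)"
        from N2[OF this] obtain ys where ys: "subseq ys (filter (\<lambda>y. \<not> P z y) zs)"
          "length ys = a \<and> sorted_wrt P ys \<or> length ys = b' \<and> sorted_wrt (\<lambda>x y. \<not> P x y) ys"
          by blast
        from ys(2) show ?thesis
        proof
          assume "length ys = b' \<and> sorted_wrt (\<lambda>x y. \<not> P x y) ys"
          then show ?thesis
            using sub[OF ys(1)] by (intro exI[of _ "z # ys"]) (simp add: ab xs)
        next
          assume "length ys = a \<and> sorted_wrt P ys"
          then show ?thesis
            using sub[OF ys(1)] by (intro exI[of _ ys]) (auto simp: xs)
        qed
      qed
    qed
  qed
qed

lemma ramsey_list:
  "\<exists>N. \<forall>P (xs :: 'a list). N \<le> length xs \<longrightarrow> (\<exists>ys. subseq ys xs \<and> length ys = m \<and>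
     (sorted_wrt P ys \<or> sorted_wrt (\<lambda>x y. \<not> P x y) ys))"
  using ramsey_list_asymmetric[of m m] by (simp flip: conj_disj_distribL)

text \<open>Ramsey's theorem is used for \<open><\<close> and then for \<open>=\<close>; pairs that
  satisfy neither are decreasing. Values are taken through \<open>f\<close>, so that a list of
  indices can be thinned again for another \<open>f\<close>.\<close>

lemma monotone_subsequence:
  obtains N where "\<And>(f :: 'a \<Rightarrow> nat) xs. N \<le> length xs \<Longrightarrow>
    \<exists>ys A. subseq ys xs \<and> length ys = m \<and> sorted_wrt (\<lambda>x y. type_rel A (f x) (f y)) ys"
proof -
  obtain N1 where N1: "\<forall>P (xs :: 'a list). N1 \<le> length xs \<longrightarrow>
      (\<exists>ys. subseq ys xs \<and> length ys = m \<and>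
        (sorted_wrt P ys \<or> sorted_wrt (\<lambda>x y. \<not> P x y) ys))"
    using ramsey_list[of m] by (rule exE)
  \<comment> \<open>\<open>max m N1\<close> serves both outcomes: an increasing list is cut to
    length \<open>m\<close>, and the other kind is long enough for the second application.\<close>
  obtain N2 where N2: "\<forall>P (xs :: 'a list). N2 \<le> length xs \<longrightarrow>
      (\<exists>ys. subseq ys xs \<and> length ys = max m N1 \<and>
        (sorted_wrt P ys \<or> sorted_wrt (\<lambda>x y. \<not> P x y) ys))"
    using ramsey_list[of "max m N1"] by (rule exE)
  show thesis
  proof (rule that[of N2])
    fix f :: "'a \<Rightarrow> nat" and xs :: "'a list" assume "N2 \<le> length xs"
    from N2[rule_format, OF this, of "\<lambda>x y. f x < f y"] obtain ys where ys: "subseq ys xs" "length ys = max m N1"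
      "sorted_wrt (\<lambda>x y. f x < f y) ys \<or> sorted_wrt (\<lambda>x y. \<not> f x < f y) ys" by blast
    from ys(3) show "\<exists>ys A. subseq ys xs \<and> length ys = m \<and>
        sorted_wrt (\<lambda>x y. type_rel A (f x) (f y)) ys"
    proof
      assume inc: "sorted_wrt (\<lambda>x y. f x < f y) ys"
      have "subseq (take m ys) xs"
        using ys(1) by (metis prefix_imp_subseq subseq_order.order_trans take_is_prefix)
      moreover have "sorted_wrt (\<lambda>x y. type_rel Incr (f x) (f y)) (take m ys)"
        using inc by (simp add: sorted_wrt_take)
      moreover have "length (take m ys) = m" using ys(2) by simp
      ultimately show ?thesis by blast
    next
      assume ninc: "sorted_wrt (\<lambda>x y. \<not> f x < f y) ys"
      have "N1 \<le> length ys" using ys(2) by simp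
      from N1[rule_format, OF this, of "\<lambda>x y. f x = f y"] obtain zs where zs: "subseq zs ys" "length zs = m"
        "sorted_wrt (\<lambda>x y. f x = f y) zs \<or> sorted_wrt (\<lambda>x y. f x \<noteq> f y) zs" by blast
      have sub: "subseq zs xs" using zs(1) ys(1) by simp
      from zs(3) show ?thesis
      proof
        assume "sorted_wrt (\<lambda>x y. f x = f y) zs"
        then have "sorted_wrt (\<lambda>x y. type_rel Constant (f x) (f y)) zs" by simp
        then show ?thesis using sub zs(2) by blast
      next
        assume "sorted_wrt (\<lambda>x y. f x \<noteq> f y) zs"
        with sorted_wrt_subseq[OF ninc zs(1)]
        have "sorted_wrt (\<lambda>x y. type_rel Decr (f x) (f y)) zs"
          by (force simp: sorted_wrt_iff_nth_less)
        then show ?thesis using sub zs(2) by blast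
      qed
    qed
  qed
qed

section \<open>Alternations\<close>

text \<open>Each of the first \<open>n\<close> slots gives an unfilled position with a filled one
  after it. The strict bound on \<open>n\<close> leaves out the last slot, which may have no entry
  after it.\<close>

lemma slots_alternation:
  assumes "0 < t" "n < slots (configuration w t)"
  obtains a b :: "nat \<Rightarrow> nat" where
    "\<And>j. j < n \<Longrightarrow> a j < length w \<and> a j \<in> set (take t (insertion_order w))"
    "\<And>j. j < n \<Longrightarrow> b j < length w \<and> b j \<notin> set (take t (insertion_order w))"
    "\<And>i j. i < j \<Longrightarrow> j < n \<Longrightarrow> max (a i) (b i) < min (a j) (b j)"
proof -
  define F where "F = set (take t (insertion_order w))"
  define g where "g i = (if i \<in> F then Some (w ! i) else None)" for i
  define k where "k = slots (configuration w t)"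
  have k: "k = slots (merge_slots (map g [0..<length w]))"
    using assms(1) by (simp add: k_def configuration_def g_def[abs_def] F_def)
  have "k - 1 = n + (k - 1 - n)" using assms(2) by (simp add: k_def)
  then have "replicate (k - 1) [True, False] =
      replicate n [True, False] @ replicate (k - 1 - n) [True, False]"
    by (metis replicate_add)
  then have "subseq (concat (replicate n [True, False])) (concat (replicate (k - 1) [True, False]))"
    by (simp add: list_emb_prefix)
  also have "subseq \<dots> (map (\<lambda>x. x = None) (map g [0..<length w]))"
    unfolding k by (rule subseq_alternation_merge_slots)
  also have "map (\<lambda>x. x = None) (map g [0..<length w]) = map (\<lambda>i. i \<notin> F) [0..<length w]"
    by (simp add: g_def)
  finally have "subseq (concat (replicate n [True, False])) (map (\<lambda>i. i \<notin> F) [0..<length w])" .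
  \<comment> \<open>In this form, parity of the index tells whether the chosen position is
    unfilled.\<close>
  moreover have "concat (replicate n [True, False]) = map even [0..<2 * n]"
    by (simp add: map_upt_double map_replicate_const)
  ultimately have "subseq (map even [0..<2 * n]) (map (\<lambda>i. i \<notin> F) [0..<length w])"
    by simp
  \<comment> \<open>The index set that picks the truth values is reused to pick the positions
    themselves.\<close>
  then obtain I where "map even [0..<2 * n] = nths (map (\<lambda>i. i \<notin> F) [0..<length w]) I"
    unfolding subseq_conv_nths by blast
  moreover define zs where "zs = nths [0..<length w] I"
  ultimately have zs: "subseq zs [0..<length w]" "map even [0..<2 * n] = map (\<lambda>i. i \<notin> F) zs"
    by (auto simp: nths_map subseq_conv_nths)
  have len: "length zs = 2 * n" using arg_cong[OF zs(2), of length] by simp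
  have sorted: "zs ! i < zs ! j" if "i < j" "j < 2 * n" for i j
    using sorted_wrt_subseq[OF _ zs(1), of "(<)"] that len by (simp add: sorted_wrt_nth_less)
  have mem: "zs ! i < length w" "zs ! i \<notin> F \<longleftrightarrow> even i" if "i < 2 * n" for i
    using subsetD[OF set_mono_subseq[OF zs(1)] nth_mem[of i]] that len
      arg_cong[OF zs(2), of "\<lambda>xs. xs ! i"]
    by simp_all
  have "zs ! (2 * j + 1) < length w \<and> zs ! (2 * j + 1) \<in> F"
    "zs ! (2 * j) < length w \<and> zs ! (2 * j) \<notin> F" if "j < n" for j
    using mem[of "2 * j"] mem[of "2 * j + 1"] that by auto
  moreover have "max (zs ! (2 * i + 1)) (zs ! (2 * i)) < min (zs ! (2 * j + 1)) (zs ! (2 * j))"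
    if "i < j" "j < n" for i j
    using that by (auto intro!: sorted)
  ultimately show thesis
    unfolding F_def by (rule that[of "\<lambda>j. zs ! (2 * j + 1)" "\<lambda>j. zs ! (2 * j)"])
qed

text \<open>A filled entry can equal an unfilled one only at the value whose insertion is under way.
  Doubling the number of pairs allows the first half to be given up to exclude this.\<close>

lemma strict_slots_alternation:
  assumes t: "0 < t" and n: "2 * n < slots (configuration w t)"
  obtains a b :: "nat \<Rightarrow> nat" where
    "\<And>j. j < n \<Longrightarrow> a j < length w \<and> b j < length w"
    "\<And>i j. i < j \<Longrightarrow> j < n \<Longrightarrow> max (a i) (b i) < min (a j) (b j)"
    "\<And>i j. i < n \<Longrightarrow> j < n \<Longrightarrow> w ! a i < w ! b j"
proof -
  define F where "F = set (take t (insertion_order w))"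
  obtain a b where a: "\<And>j. j < 2 * n \<Longrightarrow> a j < length w \<and> a j \<in> F"
    and b: "\<And>j. j < 2 * n \<Longrightarrow> b j < length w \<and> b j \<notin> F"
    and ab: "\<And>i j. i < j \<Longrightarrow> j < 2 * n \<Longrightarrow> max (a i) (b i) < min (a j) (b j)"
    using slots_alternation[OF t n] unfolding F_def by metis
  have lex: "w ! a i < w ! b j \<or> w ! a i = w ! b j \<and> a i < b j" if "i < 2 * n" "j < 2 * n" for i j
    using filled_before_unfilled[of "a i" t w "b j"] a[OF that(1)] b[OF that(2)] by (simp add: F_def)
  show thesis
  proof (cases "\<forall>i<n. \<forall>j<n. w ! a i < w ! b j")
    case True
    then show ?thesis by (intro that[of a b]) (use a b ab in auto)
  next
    case False
    then obtain i0 j0 where ij0: "i0 < n" "j0 < n" "w ! a i0 = w ! b j0"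
      using lex by (metis less_imp_le_nat linorder_not_le mult_2 trans_less_add1)
    \<comment> \<open>Some value occurs both filled and unfilled in the first half; since equal values are
      filled from left to right, it is no longer filled anywhere in the second half.\<close>
    have "w ! a (n + i) < w ! b (n + j)" if "i < n" "j < n" for i j
      using lex[of "n + i" "n + j"] lex[of "n + i" j0] lex[of i0 "n + j"]
        ab[of j0 "n + i"] that ij0 by auto
    then show ?thesis
      by (intro that[of "\<lambda>j. a (n + j)" "\<lambda>j. b (n + j)"]) (use a b ab in auto)
  qed
qed

section \<open>Embedding short members of a class into an alternation\<close>

lemma subseq_map_nth:
  assumes "sorted_wrt (<) is" "set is \<subseteq> {..<length w}"
  shows "subseq (map ((!) w) is) w"
proof -
  have "subseq is [0..<length w]"
    by (rule sorted_subset_imp_subseq) (use assms in \<open>auto intro: sorted_upt\<close>)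
  then have "subseq (map ((!) w) is) (map ((!) w) [0..<length w])" by (rule subseq_map)
  then show ?thesis by (simp add: map_nth)
qed

text \<open>The entry of \<open>\<pi>\<close> at position \<open>j\<close> is sent to the low or the
  high position of pair \<open>j\<close>, according to its side of the threshold. The types fix
  comparisons within a side, and \<open>separated\<close> fixes those across.\<close>

lemma contains_of_alternation:
  assumes \<pi>: "\<pi> \<in> vert_class A A'" and len: "length \<pi> \<le> length is"
    and bound: "\<And>i. i \<in> set is \<Longrightarrow> a i < length w \<and> b i < length w"
    and less: "sorted_wrt (\<lambda>i j. max (a i) (b i) < min (a j) (b j)) is"
    and separated: "\<And>i j. i \<in> set is \<Longrightarrow> j \<in> set is \<Longrightarrow> w ! a i < w ! b j"
    and A: "sorted_wrt (\<lambda>i j. type_rel A (w ! a i) (w ! a j)) is"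
    and A': "sorted_wrt (\<lambda>i j. type_rel A' (w ! b i) (w ! b j)) is"
  shows "contains w \<pi>"
proof -
  obtain m where m: "split_type A A' m \<pi>" and cayley: "\<pi> \<in> cayley_perms"
    using \<pi> by (auto simp: vert_class_iff)
  define pos where "pos j = (if \<pi> ! j \<le> m then a (is ! j) else b (is ! j))" for j
  define qs where "qs = map pos [0..<length \<pi>]"
  have mem: "is ! j \<in> set is" if "j < length \<pi>" for j using that len by simp
  have "pos i < pos j" if "i < j" "j < length \<pi>" for i j
    using sorted_wrt_nth_less[OF less that(1)] that len by (simp add: pos_def)
  then have "sorted_wrt (<) qs" by (simp add: qs_def sorted_wrt_iff_nth_less)
  moreover have "set qs \<subseteq> {..<length w}"
    using bound mem by (auto simp: qs_def pos_def)
  ultimately have "subseq (map ((!) w) qs) w" by (rule subseq_map_nth)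
  moreover have "standardise (map ((!) w) qs) = standardise \<pi>"
  proof (rule standardise_cong)
    show "length (map ((!) w) qs) = length \<pi>" by (simp add: qs_def)
    \<comment> \<open>Sortedness speaks only of \<open>i < j\<close>; with both comparisons stated,
      the case \<open>j < i\<close> follows by exchanging names.\<close>
    have order: "(w ! pos i \<le> w ! pos j \<longleftrightarrow> \<pi> ! i \<le> \<pi> ! j) \<and> (w ! pos j \<le> w ! pos i \<longleftrightarrow> \<pi> ! j \<le> \<pi> ! i)"
      if ij: "i < j" "j < length \<pi>" for i j
    proof -
      have ij': "is ! i \<in> set is" "is ! j \<in> set is" using mem ij by auto
      consider (low) "\<pi> ! i \<le> m" "\<pi> ! j \<le> m" | (high) "m < \<pi> ! i" "m < \<pi> ! j"
        | (low_high) "\<pi> ! i \<le> m" "m < \<pi> ! j" | (high_low) "m < \<pi> ! i" "\<pi> ! j \<le> m"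
        by linarith
      then show ?thesis
      proof cases
        case low
        then have "type_rel A (\<pi> ! i) (\<pi> ! j)"
          using m ij unfolding split_type_def sorted_wrt_filter_iff
          by (auto dest: sorted_wrt_nth_less)
        moreover have "type_rel A (w ! pos i) (w ! pos j)"
          using sorted_wrt_nth_less[OF A ij(1)] ij len low by (simp add: pos_def)
        ultimately show ?thesis by (metis type_rel_le_iff)
      next
        case high
        then have "type_rel A' (\<pi> ! i) (\<pi> ! j)"
          using m ij unfolding split_type_def sorted_wrt_filter_iff
          by (auto dest: sorted_wrt_nth_less)
        moreover have "type_rel A' (w ! pos i) (w ! pos j)"
          using sorted_wrt_nth_less[OF A' ij(1)] ij len high by (simp add: pos_def)
        ultimately show ?thesis by (metis type_rel_le_iff)
      next
        case low_high
        then show ?thesis using separated[OF ij'] by (simp add: pos_def)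
      next
        case high_low
        then show ?thesis using separated[OF ij'(2,1)] by (simp add: pos_def)
      qed
    qed
    show "map ((!) w) qs ! i \<le> map ((!) w) qs ! j \<longleftrightarrow> \<pi> ! i \<le> \<pi> ! j"
      if "i < length \<pi>" "j < length \<pi>" for i j
      using order[of i j] order[of j i] that
      by (cases i j rule: linorder_cases) (auto simp: qs_def)
  qed
  ultimately show ?thesis
    using standardise_cayley[OF cayley] by (auto simp: contains_def)
qed

text \<open>The types are those that Ramsey's theorem finds in \<open>w\<close>, while
  \<open>N\<close> depends on \<open>m\<close> alone.\<close>

lemma many_slots_contains:
  obtains N where "\<And>w t. 0 < t \<Longrightarrow> N < slots (configuration w t) \<Longrightarrow>
    \<exists>A A'. \<forall>\<pi> \<in> vert_class A A'. length \<pi> \<le> m \<longrightarrow> contains w \<pi>"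
proof -
  obtain N1 where N1: "\<And>(f :: nat \<Rightarrow> nat) xs. N1 \<le> length xs \<Longrightarrow>
    \<exists>ys A. subseq ys xs \<and> length ys = m \<and> sorted_wrt (\<lambda>x y. type_rel A (f x) (f y)) ys"
    using monotone_subsequence[of m, where 'a = nat] by metis
  \<comment> \<open>The small entries are thinned first, to \<open>N1\<close> indices, enough to
    thin the large entries to \<open>m\<close> afterwards; the small ones keep their type.\<close>
  obtain N2 where N2: "\<And>(f :: nat \<Rightarrow> nat) xs. N2 \<le> length xs \<Longrightarrow>
    \<exists>ys A. subseq ys xs \<and> length ys = N1 \<and> sorted_wrt (\<lambda>x y. type_rel A (f x) (f y)) ys"
    using monotone_subsequence[of N1, where 'a = nat] by metis
  show thesis
  \<comment> \<open>The factor 2 pays for strictness of the alternation.\<close>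
  proof (rule that[of "2 * N2"])
    fix w t assume "0 < t" "2 * N2 < slots (configuration w t)"
    then obtain a b where ab: "\<And>j. j < N2 \<Longrightarrow> a j < length w \<and> b j < length w"
      "\<And>i j. i < j \<Longrightarrow> j < N2 \<Longrightarrow> max (a i) (b i) < min (a j) (b j)"
      "\<And>i j. i < N2 \<Longrightarrow> j < N2 \<Longrightarrow> w ! a i < w ! b j"
      using strict_slots_alternation by metis
    have "N2 \<le> length [0..<N2]" by simp
    from N2[OF this, of "\<lambda>i. w ! a i"] obtain js A where js: "subseq js [0..<N2]" "length js = N1"
      "sorted_wrt (\<lambda>i j. type_rel A (w ! a i) (w ! a j)) js" by blast
    from N1[of js "\<lambda>i. w ! b i"] js(2) obtain "is" A' where "is": "subseq is js" "length is = m"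
      "sorted_wrt (\<lambda>i j. type_rel A' (w ! b i) (w ! b j)) is" by blast
    have sub: "subseq is [0..<N2]" using js(1) "is"(1) by simp
    have bound: "i < N2" if "i \<in> set is" for i
      using set_mono_subseq[OF sub] that by auto
    have "sorted_wrt (\<lambda>i j. max (a i) (b i) < min (a j) (b j)) [0..<N2]"
      using ab(2) by (simp add: sorted_wrt_iff_nth_less)
    then have "sorted_wrt (\<lambda>i j. max (a i) (b i) < min (a j) (b j)) is"
      using sub by (rule sorted_wrt_subseq)
    then have "contains w \<pi>" if "\<pi> \<in> vert_class A A'" "length \<pi> \<le> m" for \<pi>
      using that "is" ab bound sorted_wrt_subseq[OF js(3) "is"(1)]
      by (intro contains_of_alternation[of \<pi> A A' "is" a w b]) auto
    then show "\<exists>A A'. \<forall>\<pi> \<in> vert_class A A'. length \<pi> \<le> m \<longrightarrow> contains w \<pi>" by blast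
  qed
qed

section \<open>Members of each class with arbitrarily many slots\<close>

text \<open>The even positions hold the \<open>n\<close> smallest entries and so are the ones filled
  after \<open>n\<close> insertions; every odd position is then a slot of its own.\<close>

lemma slots_low_even_positions:
  assumes len: "length w = 2 * n" and "0 < n"
    and low: "\<And>i j. even i \<Longrightarrow> odd j \<Longrightarrow> i < 2 * n \<Longrightarrow> j < 2 * n \<Longrightarrow> w ! i < w ! j"
  shows "slots (configuration w n) = n"
proof -
  define F where "F = set (take n (insertion_order w))"
  define E where "E = {i. i < 2 * n \<and> even i}"
  have "E = (\<lambda>i. 2 * i) ` {..<n}" by (auto simp: E_def elim!: evenE)
  then have "card E = n" by (simp add: card_image inj_on_def)
  have "finite E" by (simp add: E_def)
  have "card F = n"
    using len by (simp add: F_def distinct_card distinct_take distinct_insertion_order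
        length_insertion_order)
  have F_sub: "F \<subseteq> {..<2 * n}"
    using set_take_subset[of n "insertion_order w"] by (simp add: F_def set_insertion_order len)
  \<comment> \<open>Both sets have \<open>n\<close> elements. If they differed, neither would
    contain the other, so an odd position would be filled before a smaller entry at an even
    one.\<close>
  have "F = E"
  proof (rule ccontr)
    assume "F \<noteq> E"
    have "\<not> F \<subseteq> E"
      using \<open>F \<noteq> E\<close> \<open>card F = n\<close> \<open>card E = n\<close> card_subset_eq[OF \<open>finite E\<close>, of F] by metis
    then obtain j where j: "j \<in> F" "j \<notin> E" by blast
    have "finite F" by (simp add: F_def)
    have "\<not> E \<subseteq> F"
      using \<open>F \<noteq> E\<close> \<open>card F = n\<close> \<open>card E = n\<close> card_subset_eq[OF \<open>finite F\<close>, of E] by metis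
    then obtain i where i: "i \<in> E" "i \<notin> F" by blast
    have "w ! i < w ! j" using i(1) j F_sub by (intro low) (auto simp: E_def)
    moreover have "w ! j < w ! i \<or> w ! j = w ! i \<and> j < i"
      using i j len by (intro filled_before_unfilled) (auto simp: E_def F_def)
    ultimately show False by simp
  qed
  have "map (\<lambda>i. if i \<in> F then Some (w ! i) else None) [0..<length w] =
      concat (map (\<lambda>i. [Some (w ! (2 * i)), None]) [0..<n])"
    unfolding len map_upt_double \<open>F = E\<close>
    by (intro arg_cong[of _ _ concat]) (auto simp: E_def)
  then show ?thesis
    using \<open>0 < n\<close> by (simp add: configuration_def F_def slots_merge_slots_alternating)
qed

text \<open>For \<open>i < n\<close> all values lie between 1 and \<open>n\<close>, so adding
  \<open>n\<close> lifts a second sequence above the first.\<close>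

fun type_entry :: "seq_type \<Rightarrow> nat \<Rightarrow> nat \<Rightarrow> nat" where
  "type_entry Incr n i = i + 1"
| "type_entry Decr n i = n - i"
| "type_entry Constant n i = 1"

lemma type_entry_bounds: "i < n \<Longrightarrow> 0 < type_entry A n i \<and> type_entry A n i \<le> n"
  by (cases A) auto

lemma type_rel_type_entry: "i < j \<Longrightarrow> j < n \<Longrightarrow> type_rel A (type_entry A n i) (type_entry A n j)"
  by (cases A) auto

lemma type_rel_add: "type_rel A (c + x) (c + y) \<longleftrightarrow> type_rel A x y"
  by (cases A) auto

lemma vert_class_many_slots:
  assumes "0 < n"
  obtains w where "w \<in> vert_class A A'" "length w = 2 * n" "slots (configuration w n) = n"
proof -
  \<comment> \<open>The low sequence occupies the even positions, the lifted high one the odd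
    positions, and \<open>n\<close> is the threshold.\<close>
  define h where "h i = (if even i then type_entry A n (i div 2)
    else n + type_entry A' n (i div 2))" for i
  define v where "v = map h [0..<2 * n]"
  have parity: "h i \<le> n \<longleftrightarrow> even i" if "i < 2 * n" for i
    using that type_entry_bounds[of "i div 2" n A] type_entry_bounds[of "i div 2" n A']
    by (auto simp: h_def)
  have "split_type A A' n v"
    unfolding split_type_def sorted_wrt_filter_iff
    unfolding sorted_wrt_iff_nth_less
  proof (intro conjI allI impI)
    fix i j assume ij: "i < j" "j < length v"
    then have ij': "i < 2 * n" "j < 2 * n" "v ! i = h i" "v ! j = h j" by (simp_all add: v_def)
    have div: "i div 2 < j div 2" if "even i \<longleftrightarrow> even j"
      using that ij(1) by presburger
    have "j div 2 < n" using ij' by simp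
    show "type_rel A (v ! i) (v ! j)" if "v ! i \<le> n" "v ! j \<le> n"
    proof -
      have "even i" "even j" using that parity ij' by auto
      then show ?thesis
        using type_rel_type_entry[OF div \<open>j div 2 < n\<close>] by (simp add: ij' h_def)
    qed
    show "type_rel A' (v ! i) (v ! j)" if "n < v ! i" "n < v ! j"
    proof -
      have "odd i" "odd j" using that parity ij' by (auto simp: not_le[symmetric])
      then show ?thesis
        using type_rel_type_entry[OF div \<open>j div 2 < n\<close>] by (simp add: ij' h_def type_rel_add)
    qed
  qed
  \<comment> \<open>\<open>v\<close> may skip values, for instance if a part is constant;
    standardising closes the gaps and keeps all comparisons.\<close>
  then have 1: "standardise v \<in> vert_class A A'" by (rule standardise_in_vert_class)
  have len: "length (standardise v) = 2 * n" by (simp add: v_def)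
  have "standardise v ! i < standardise v ! j"
    if "even i" "odd j" "i < 2 * n" "j < 2 * n" for i j
  proof -
    have "v ! i < v ! j" using that parity[of i] parity[of j] by (simp add: v_def)
    then show ?thesis
      using that standardise_nth_le_iff[of j v i] by (simp add: v_def not_le[symmetric])
  qed
  then have "slots (configuration (standardise v) n) = n"
    using slots_low_even_positions[OF len \<open>0 < n\<close>] by blast
  with 1 len show thesis by (rule that)
qed

section \<open>Bounded slots and the nine classes\<close>

lemma UNIV_seq_type: "UNIV = {Incr, Decr, Constant}"
  using seq_type.exhaust by auto

theorem theorem3p5:
  fixes B :: "nat list set"
  assumes "B \<subseteq> cayley_perms"
  shows "(\<exists>k>0. Av B \<subseteq> SB k) \<longleftrightarrow> (\<forall>A A'. B \<inter> vert_class A A' \<noteq> {})"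
proof (intro iffI allI notI)
  fix A A'
  assume "\<exists>k>0. Av B \<subseteq> SB k" and empty: "B \<inter> vert_class A A' = {}"
  then obtain k where k: "Av B \<subseteq> SB k" by blast
  \<comment> \<open>This word has one slot too many for \<open>SB k\<close> after
    \<open>Suc k\<close> insertions, a stage within its length.\<close>
  obtain w where w: "w \<in> vert_class A A'" "length w = 2 * Suc k"
    "slots (configuration w (Suc k)) = Suc k"
    using vert_class_many_slots by blast
  have "\<not> contains w p" if "p \<in> B" for p
    using vert_class_contains[OF w(1)] that empty by blast
  then have "w \<in> Av B" using w(1) by (simp add: Av_def vert_class_iff)
  then have "w \<in> SB k" using k by blast
  then have "slots (configuration w (Suc k)) \<le> k" using w(2) by (simp add: SB_def)
  then show False using w(3) by simp
next
  assume "\<forall>A A'. B \<inter> vert_class A A' \<noteq> {}"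
  then have "\<forall>A A'. \<exists>p. p \<in> B \<inter> vert_class A A'" by blast
  then obtain p where p: "\<And>A A'. p A A' \<in> B \<inter> vert_class A A'" by metis
  \<comment> \<open>One element of \<open>B\<close> is fixed per class; as there are nine classes,
    the chosen lengths are bounded even if \<open>B\<close> is infinite.\<close>
  have "\<exists>m. \<forall>A A'. length (p A A') \<le> m"
  proof (intro exI allI)
    fix A A'
    have "finite (range (\<lambda>(A, A'). length (p A A')))"
      by (simp add: UNIV_seq_type flip: UNIV_Times_UNIV)
    moreover have "length (p A A') \<in> range (\<lambda>(A, A'). length (p A A'))"
      by (rule range_eqI[of _ _ "(A, A')"]) simp
    ultimately show "length (p A A') \<le> Max (range (\<lambda>(A, A'). length (p A A')))"
      by (rule Max_ge)
  qed
  then obtain m where m: "\<And>A A'. length (p A A') \<le> m" by blast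
  obtain N where N: "\<And>w t. 0 < t \<Longrightarrow> N < slots (configuration w t) \<Longrightarrow>
    \<exists>A A'. \<forall>\<pi> \<in> vert_class A A'. length \<pi> \<le> m \<longrightarrow> contains w \<pi>"
    using many_slots_contains[of m] by metis
  \<comment> \<open>\<open>Suc N\<close> is positive and also covers the single slot of the initial
    configuration, where \<open>N\<close> gives no information.\<close>
  have "w \<in> SB (Suc N)" if w: "w \<in> Av B" for w
  proof -
    have "slots (configuration w t) \<le> Suc N" for t
    proof (rule ccontr)
      assume "\<not> slots (configuration w t) \<le> Suc N"
      moreover from this have "0 < t"
        by (cases t) (simp_all add: configuration_def slots_def)
      ultimately obtain A A' where "\<forall>\<pi> \<in> vert_class A A'. length \<pi> \<le> m \<longrightarrow> contains w \<pi>"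
        using N[of t w] by auto
      then have "contains w (p A A')" using p m by blast
      then show False using w p by (auto simp: Av_def)
    qed
    then show ?thesis using w by (simp add: SB_def Av_def)
  qed
  then show "\<exists>k>0. Av B \<subseteq> SB k" by blast
qed

end
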